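(* Let $j\in\{2,3,4\}$, $\lambda\in\{1,-1\}$, let $r>0$ be constant, and let $\beta$ be a unit-speed spacelike curve in $\mathbb{E}^4_1$ with non-null Frenet frame $\{F_1,F_2,F_3,F_4\}$ whose timelike member is $F_j$. Let $M$ be the tubular hypersurface $$\mathcal{T}^{\{j,\lambda\}}(s,t,w)=\beta(s)+r\sum_{i=2}^4\mu_i^{\lambda}F_i(s)$$ with Gauss map $N^{\{j,\lambda\}}=-(-1)^{(4-j)!}\lambda^j\sum_{i=2}^4\mu_i^\lambda F_i$. Then $M$ cannot have $\mathcal{L}_1$-harmonic Gauss map; that is, $\mathcal{L}_1N^{\{j,\lambda\}}=0$ does not hold (identically) on $M$.
   Context: $\mathbb{E}^4_1$ is $\mathbb{R}^4$ with the metric $\langle\ ,\ \rangle=-dx_1^2+dx_2^2+dx_3^2+dx_4^2$. The curve $\beta:I\to\mathbb{E}^4_1$ ($I$ an open interval) is smooth with $\beta'=F_1$, and $\{F_1,\dots,F_4\}$ is a smooth orthonormal frame along $\beta$ with $\langle F_j,F_j\rangle=-1$ and $\langle F_i,F_i\rangle=1$ for $i\neq j$, satisfying, with smooth curvature functions $k_1,k_2,k_3$ of $s$, the Frenet equations - $j=2$: $F_1'=k_1F_2$, $F_2'=k_1F_1+k_2F_3$, $F_3'=k_2F_2+k_3F_4$, $F_4'=-k_3F_3$; - $j=3$: $F_1'=k_1F_2$, $F_2'=-k_1F_1+k_2F_3$, $F_3'=k_2F_2+k_3F_4$, $F_4'=k_3F_3$; - $j=4$: $F_1'=k_1F_2$,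 $F_2'=-k_1F_1+k_2F_3$, $F_3'=-k_2F_2+k_3F_4$, $F_4'=k_3F_3$. The functions $\mu_i^\lambda$ (depending on $j$) are given by $\mu_j^\lambda=(\sinh w)^{\frac{1+\lambda}2}(\cosh w)^{\frac{1-\lambda}2}\cosh t$, $\mu_{j+1}^\lambda=(\sinh w)^{\frac{1-\lambda}2}(\cosh w)^{\frac{1+\lambda}2}$, $\mu_{j+2}^\lambda=(\sinh w)^{\frac{1+\lambda}2}(\cosh w)^{\frac{1-\lambda}2}\sinh t$, with the index convention $\mu_5^\lambda=\mu_2^\lambda$, $\mu_6^\lambda=\mu_3^\lambda$. ($\lambda=1$: envelope of pseudo hyperspheres; $\lambda=-1$: envelope of pseudo hyperbolic hyperspheres, of radius $r$ centered on $\beta$.) The parameters $(s,t,w)$ range over a (nonempty) connected open set $U\subset I\times\mathbb{R}^2$ projecting onto $I$ on which $\mathcal{T}^{\{j,\lambda\}}$ is an immersion, i.e. $(\mu_{j+1}^\lambda)_w\neq0$ and $1+(-1)^{(4-j)!}rk_1\mu_2^\lambda\neq0$. The unit normal $N=N^{\{j,\lambda\}}$ has $\varepsilon=\langle N,N\rangle=\lambda$, and the principal curvatures with respect to $N$ (eigenvalues of $-dN$) are $\kappa_1=\kappa_2=\frac{(-1)^{(4-j)!}\lambda^j}{r}$, $\kappa_3=\frac{k_1\mu_2^\lambda}{\lambda^j(1+(-1)^{(4-j)!}rk_1\mu_2^\lambda)}$. Operator $\mathcal{L}_1$ (Cheng–Yau) on the Gauss map: put $a_1=-\sum_i\kappa_i$,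 $a_k=(-1)^k\sum_{i_1<\dots<i_k}\kappa_{i_1}\cdots\kappa_{i_k}$ ($k=2,3$), and define $H_k$ by $\binom{3}{k}H_k=(-\varepsilon)^ka_k$. Then $$\mathcal{L}_1N=-\varepsilon\,\mathfrak{C}_1\big(\nabla H_2+(3H_1H_2-H_3)N\big),\qquad \mathfrak{C}_1=\binom32(-\varepsilon)=-3\varepsilon,$$ where $\nabla$ is the gradient on $M$ with respect to the induced metric, viewed as an $\mathbb{E}^4_1$-valued map. *)

theory Defs
  imports "HOL-Analysis.Analysis" "HOL-Computational_Algebra.Polynomial"
begin

text \<open>The space \<open>\<real>\<^sup>4\<close> with the Lorentzian product of signature \<open>(-,+,+,+)\<close>.\<close>

definition mink :: "real ^ 4 \<Rightarrow> real ^ 4 \<Rightarrow> real" where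
  "mink x y = - x $ 1 * y $ 1 + x $ 2 * y $ 2 + x $ 3 * y $ 3 + x $ 4 * y $ 4"

text \<open>\<open>C\<^sup>\<infinity>\<close> on an open set of reals: \<open>D n\<close> is the \<open>n\<close>-th derivative.\<close>

definition smooth_curve_on :: "real set \<Rightarrow> (real \<Rightarrow> 'a::real_normed_vector) \<Rightarrow> bool" where
  "smooth_curve_on I f \<longleftrightarrow>
     (\<exists>D :: nat \<Rightarrow> real \<Rightarrow> 'a. \<forall>s\<in>I. D 0 s = f s \<and>
        (\<forall>n. (D n has_vector_derivative D (Suc n) s) (at s)))"

subsection \<open>Spacelike curves with non-null Frenet frame\<close>

text \<open>\<open>frenet_curve j I \<beta> F k\<close>: on \<open>I\<close>, the curve \<open>\<beta>\<close> has velocity \<open>F 1\<close>, and \<open>F 1, \<dots>, F 4\<close> is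
  its orthonormal Frenet frame, with timelike member \<open>F j\<close> and curvatures \<open>k 1, k 2, k 3\<close>.  The
  members \<open>F i\<close> and \<open>k i\<close> with other indices are irrelevant.  For \<open>j \<noteq> 1\<close> the orthonormality
  relations say in particular that \<open>\<beta>\<close> is spacelike and of unit speed.\<close>

definition frenet_curve ::
  "nat \<Rightarrow> real set \<Rightarrow> (real \<Rightarrow> real ^ 4) \<Rightarrow> (nat \<Rightarrow> real \<Rightarrow> real ^ 4) \<Rightarrow> (nat \<Rightarrow> real \<Rightarrow> real) \<Rightarrow> bool"
where
  "frenet_curve j I \<beta> F k \<longleftrightarrow>
     smooth_curve_on I \<beta> \<and>
     (\<forall>i\<in>{1..4}. smooth_curve_on I (F i)) \<and>
     (\<forall>i\<in>{1..3}. smooth_curve_on I (k i)) \<and>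
     (\<forall>s\<in>I. (\<beta> has_vector_derivative F 1 s) (at s)) \<and>
     (\<forall>s\<in>I. \<forall>i\<in>{1..4}. \<forall>l\<in>{1..4}.
        mink (F i s) (F l s) = (if i \<noteq> l then 0 else if i = j then -1 else 1)) \<and>
     (j = 2 \<longrightarrow> (\<forall>s\<in>I.
        (F 1 has_vector_derivative k 1 s *\<^sub>R F 2 s) (at s) \<and>
        (F 2 has_vector_derivative k 1 s *\<^sub>R F 1 s + k 2 s *\<^sub>R F 3 s) (at s) \<and>
        (F 3 has_vector_derivative k 2 s *\<^sub>R F 2 s + k 3 s *\<^sub>R F 4 s) (at s) \<and>
        (F 4 has_vector_derivative - k 3 s *\<^sub>R F 3 s) (at s))) \<and>
     (j = 3 \<longrightarrow> (\<forall>s\<in>I.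
        (F 1 has_vector_derivative k 1 s *\<^sub>R F 2 s) (at s) \<and>
        (F 2 has_vector_derivative - k 1 s *\<^sub>R F 1 s + k 2 s *\<^sub>R F 3 s) (at s) \<and>
        (F 3 has_vector_derivative k 2 s *\<^sub>R F 2 s + k 3 s *\<^sub>R F 4 s) (at s) \<and>
        (F 4 has_vector_derivative k 3 s *\<^sub>R F 3 s) (at s))) \<and>
     (j = 4 \<longrightarrow> (\<forall>s\<in>I.
        (F 1 has_vector_derivative k 1 s *\<^sub>R F 2 s) (at s) \<and>
        (F 2 has_vector_derivative - k 1 s *\<^sub>R F 1 s + k 2 s *\<^sub>R F 3 s) (at s) \<and>
        (F 3 has_vector_derivative - k 2 s *\<^sub>R F 2 s + k 3 s *\<^sub>R F 4 s) (at s) \<and>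
        (F 4 has_vector_derivative k 3 s *\<^sub>R F 3 s) (at s)))"

subsection \<open>Tubular hypersurfaces\<close>

text \<open>Indices of \<open>\<mu>\<close> are read cyclically in \<open>{2, 3, 4}\<close>, so that \<open>5\<close> stands for \<open>2\<close> and \<open>6\<close>
  for \<open>3\<close>.\<close>

definition cyc :: "nat \<Rightarrow> nat" where
  "cyc m = (if m > 4 then m - 3 else m)"

text \<open>For \<open>lam = 1\<close> and \<open>lam = -1\<close> the exponents below are the integers \<open>0\<close> and \<open>1\<close>, hence the use
  of integer powers; \<open>0 powi 0 = 1\<close> is the intended value where \<open>sinh w = 0\<close>.\<close>

definition mu :: "nat \<Rightarrow> int \<Rightarrow> nat \<Rightarrow> real \<Rightarrow> real \<Rightarrow> real" where
  "mu j lam i t w =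
     (if i = j then sinh w powi ((1 + lam) div 2) * cosh w powi ((1 - lam) div 2) * cosh t
      else if i = cyc (j + 1) then sinh w powi ((1 - lam) div 2) * cosh w powi ((1 + lam) div 2)
      else if i = cyc (j + 2) then sinh w powi ((1 + lam) div 2) * cosh w powi ((1 - lam) div 2) * sinh t
      else 0)"

text \<open>The parameters are \<open>s = p $ 1\<close>, \<open>t = p $ 2\<close>, \<open>w = p $ 3\<close>.\<close>

definition tube ::
  "nat \<Rightarrow> int \<Rightarrow> real \<Rightarrow> (real \<Rightarrow> real ^ 4) \<Rightarrow> (nat \<Rightarrow> real \<Rightarrow> real ^ 4) \<Rightarrow> real ^ 3 \<Rightarrow> real ^ 4"
where
  "tube j lam r \<beta> F p =
     \<beta> (p $ 1) + r *\<^sub>R (\<Sum>i = 2..4. mu j lam i (p $ 2) (p $ 3) *\<^sub>R F i (p $ 1))"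

definition tube_normal ::
  "nat \<Rightarrow> int \<Rightarrow> (nat \<Rightarrow> real \<Rightarrow> real ^ 4) \<Rightarrow> real ^ 3 \<Rightarrow> real ^ 4"
where
  "tube_normal j lam F p =
     - ((-1) ^ fact (4 - j) * of_int lam ^ j) *\<^sub>R
       (\<Sum>i = 2..4. mu j lam i (p $ 2) (p $ 3) *\<^sub>R F i (p $ 1))"

subsection \<open>Parametrized hypersurfaces and the Cheng--Yau operator on the Gauss map\<close>

definition immersion_on :: "(real ^ 3 \<Rightarrow> real ^ 4) \<Rightarrow> (real ^ 3) set \<Rightarrow> bool" where
  "immersion_on X U \<longleftrightarrow>
     (\<forall>p\<in>U. X differentiable (at p) \<and> inj (frechet_derivative X (at p)))"

text \<open>In the following, \<open>X\<close> is an immersion near \<open>p\<close> with non-null unit normal field \<open>N\<close>.  Its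
  differential identifies the tangent space at \<open>p\<close> with \<open>\<real>\<^sup>3\<close>.  Under this identification the
  shape operator \<open>- dN\<close> is the unique matrix \<open>S\<close> such that \<open>dX (S v) = - dN v\<close> for all \<open>v\<close>.\<close>

definition shape_operator ::
  "(real ^ 3 \<Rightarrow> real ^ 4) \<Rightarrow> (real ^ 3 \<Rightarrow> real ^ 4) \<Rightarrow> real ^ 3 \<Rightarrow> real ^ 3 ^ 3"
where
  "shape_operator X N p =
     (THE S. \<forall>v. frechet_derivative X (at p) (S *v v) = - frechet_derivative N (at p) v)"

definition charpoly :: "real ^ 3 ^ 3 \<Rightarrow> real poly" where
  "charpoly A = det (\<chi> i l. (if i = l then [:0, 1:] else 0) - [:A $ i $ l:])"

text \<open>The real eigenvalues of the shape operator, repeated according to algebraic multiplicity.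
  There are three of them when all its eigenvalues are real, which a Lorentzian induced metric does
  not guarantee in general.\<close>

definition principal_curvatures ::
  "(real ^ 3 \<Rightarrow> real ^ 4) \<Rightarrow> (real ^ 3 \<Rightarrow> real ^ 4) \<Rightarrow> real ^ 3 \<Rightarrow> real list"
where
  "principal_curvatures X N p =
     sorted_list_of_multiset (proots (charpoly (shape_operator X N p)))"

definition curv_coeff ::
  "(real ^ 3 \<Rightarrow> real ^ 4) \<Rightarrow> (real ^ 3 \<Rightarrow> real ^ 4) \<Rightarrow> nat \<Rightarrow> real ^ 3 \<Rightarrow> real"
where
  "curv_coeff X N k p =
     (let \<kappa> = principal_curvatures X N p in
      (-1) ^ k * (\<Sum>A | A \<subseteq> {..<length \<kappa>} \<and> card A = k. \<Prod>i\<in>A. \<kappa> ! i))"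

definition mean_curv ::
  "(real ^ 3 \<Rightarrow> real ^ 4) \<Rightarrow> (real ^ 3 \<Rightarrow> real ^ 4) \<Rightarrow> nat \<Rightarrow> real ^ 3 \<Rightarrow> real"
where
  "mean_curv X N k p = (- mink (N p) (N p)) ^ k * curv_coeff X N k p / real (3 choose k)"

text \<open>The gradient of \<open>f\<close> with respect to the induced metric, as a vector of the ambient space: the
  unique tangent vector representing \<open>df\<close>.\<close>

definition surf_grad ::
  "(real ^ 3 \<Rightarrow> real ^ 4) \<Rightarrow> (real ^ 3 \<Rightarrow> real) \<Rightarrow> real ^ 3 \<Rightarrow> real ^ 4"
where
  "surf_grad X f p =
     (THE V. V \<in> range (frechet_derivative X (at p)) \<and>
        (\<forall>v. mink V (frechet_derivative X (at p) v) = frechet_derivative f (at p) v))"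

text \<open>The value of the Cheng--Yau operator \<open>L\<^sub>1\<close> on the Gauss map \<open>N\<close>, with
  \<open>\<epsilon> = \<langle>N, N\<rangle>\<close>: it is given by
  \<open>L\<^sub>1 N = - \<epsilon> C\<^sub>1 (\<nabla> H\<^sub>2 + (3 H\<^sub>1 H\<^sub>2 - H\<^sub>3) N)\<close> where
  \<open>C\<^sub>1 = (3 choose 2) (- \<epsilon>)\<close>.\<close>

definition L1_gauss ::
  "(real ^ 3 \<Rightarrow> real ^ 4) \<Rightarrow> (real ^ 3 \<Rightarrow> real ^ 4) \<Rightarrow> real ^ 3 \<Rightarrow> real ^ 4"
where
  "L1_gauss X N p =
     (let \<epsilon> = mink (N p) (N p);
          C1 = real (3 choose 2) * (- \<epsilon>);
          H = (\<lambda>k. mean_curv X N k)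
      in (- \<epsilon> * C1) *\<^sub>R
           (surf_grad X (H 2) p + (3 * H 1 p * H 2 p - H 3 p) *\<^sub>R N p))"

definition L1_harmonic_gauss_on ::
  "(real ^ 3 \<Rightarrow> real ^ 4) \<Rightarrow> (real ^ 3 \<Rightarrow> real ^ 4) \<Rightarrow> (real ^ 3) set \<Rightarrow> bool"
where
  "L1_harmonic_gauss_on X N U \<longleftrightarrow> (\<forall>p\<in>U. L1_gauss X N p = 0)"

end

theory Submission
  imports Defs
begin

text \<open>Let \<open>X = \<beta> + r Y\<close>, so that \<open>N = - \<rho> Y\<close> with \<open>\<rho> = \<plusminus>1\<close>. The tangent spaces are
  \<open>Y\<^sup>\<bottom>\<close>, and on them \<open>- dN = \<rho> dY\<close> agrees with \<open>\<rho>/r dX\<close> except in the direction \<open>s\<close>.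
  Hence \<open>c = \<rho>/r\<close> is a double principal curvature; the third one, \<open>\<kappa>\<close>, is read off from the
  component along \<open>F 1\<close>.  Since \<open>\<nabla> H\<^sub>2\<close> is tangent, \<open>L\<^sub>1 N = 0\<close> at a point forces
  \<open>3 H\<^sub>1 H\<^sub>2 - H\<^sub>3 = \<epsilon> 2/3 c (c\<^sup>2 + c \<kappa> + \<kappa>\<^sup>2)\<close> to vanish there, which is impossible as \<open>c \<noteq> 0\<close>.\<close>

section \<open>Linear algebra of the Lorentzian product and of hyperplanes with non-null
  normal\<close>

lemma bounded_bilinear_mink: "bounded_bilinear mink"
proof -
  have "linear (\<lambda>y. mink x y)" "linear (\<lambda>x. mink x y)" for x y
    unfolding mink_def by (auto intro!: linearI simp: algebra_simps)
  then have "bilinear mink"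
    by (simp add: bilinear_def)
  then show ?thesis
    by (simp add: bilinear_conv_bounded_bilinear)
qed

interpretation mink: bounded_bilinear mink
  by (rule bounded_bilinear_mink)

lemma mink_commute: "mink x y = mink y x"
  by (simp add: mink_def mult.commute)

lemma mink_nondegenerate:
  assumes "\<And>y. mink x y = 0"
  shows "x = 0"
proof -
  have "x $ i = 0" for i
    using assms[of "axis i 1"] exhaust_4[of i] by (auto simp: mink_def axis_def)
  then show ?thesis
    by (simp add: vec_eq_iff)
qed

lemma mink_orthogonal_dim:
  assumes "n \<noteq> 0"
  shows "subspace {x. mink n x = 0}" and "dim {x. mink n x = 0} = 3"
proof -
  \<comment> \<open>Flipping the time component turns the Lorentzian orthogonal complement of
    \<open>n\<close> into a Euclidean hyperplane, whose dimension is known.\<close>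
  define m :: "real ^ 4" where "m = (\<chi> i. if i = 1 then - n $ 1 else n $ i)"
  have eq: "{x. mink n x = 0} = {x. m \<bullet> x = 0}"
    by (simp add: mink_def m_def inner_vec_def sum_4)
  have "m \<noteq> 0"
    using assms by (auto simp: m_def vec_eq_iff forall_4)
  then show "subspace {x. mink n x = 0}" "dim {x. mink n x = 0} = 3"
    unfolding eq by (simp_all add: subspace_hyperplane dim_hyperplane)
qed

text \<open>One inclusion is the orthogonality hypothesis; injectivity gives \<open>range L\<close>
  dimension 3, which is also the dimension of the hyperplane.\<close>

lemma range_eq_mink_orthogonal:
  fixes L :: "real ^ 3 \<Rightarrow> real ^ 4"
  assumes "linear L" "inj L" "n \<noteq> 0" "\<And>v. mink n (L v) = 0"
  shows "range L = {x. mink n x = 0}"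
proof (rule subspace_dim_equal)
  show "subspace (range L)"
    using assms(1) by (simp add: linear_subspace_image)
  show "dim {x. mink n x = 0} \<le> dim (range L)"
    using mink_orthogonal_dim(2)[OF assms(3)] dim_image_eq[of L UNIV] assms(1,2)
    by simp
qed (use assms mink_orthogonal_dim in auto)

text \<open>The induced metric may be indefinite, so nondegeneracy has to replace positivity. It
  holds because \<open>n\<close> is non-null; the Gram map of \<open>L\<close> is then injective,
  and surjective by dimension.\<close>

lemma mink_gradient_ex1:
  fixes L :: "real ^ 3 \<Rightarrow> real ^ 4" and f :: "real ^ 3 \<Rightarrow> real"
  assumes L: "linear L" "inj L" and n: "mink n n \<noteq> 0" "\<And>v. mink n (L v) = 0"
    and f: "linear f"
  shows "\<exists>!V. V \<in> range L \<and> (\<forall>v. mink V (L v) = f v)"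
proof -
  have "n \<noteq> 0"
    using n by (auto simp: mink.zero_left)
  then have range_L: "range L = {x. mink n x = 0}"
    using range_eq_mink_orthogonal L n by blast
  have nondeg: "V = 0" if V: "V \<in> range L" "\<And>v. mink V (L v) = 0" for V
  proof (rule mink_nondegenerate)
    fix y
    \<comment> \<open>Subtracting \<open>a\<close> times \<open>n\<close> leaves the tangential part
      of \<open>y\<close>. A tangent \<open>V\<close> orthogonal to \<open>range L\<close>
      annihilates both parts.\<close>
    define a where "a = mink n y / mink n n"
    have "mink n (y - a *\<^sub>R n) = 0"
      using n by (simp add: a_def mink.diff_right mink.scaleR_right)
    then have "y - a *\<^sub>R n \<in> range L"
      using range_L by blast
    then have "mink V (y - a *\<^sub>R n) = 0"
      using V(2) by auto
    moreover have "mink V n = 0"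
      using V(1) range_L by (simp add: mink_commute)
    ultimately show "mink V y = 0"
      by (simp add: mink.diff_right mink.scaleR_right)
  qed
  \<comment> \<open>This is the Gram matrix of the induced metric applied to \<open>u\<close>;
    finding the gradient means solving \<open>G u = (f e_1, f e_2, f e_3)\<close>.\<close>
  define G :: "real ^ 3 \<Rightarrow> real ^ 3" where "G u = (\<chi> i. mink (L u) (L (axis i 1)))" for u
  have "linear G"
    by (rule linearI)
      (auto simp: G_def vec_eq_iff linear_add[OF L(1)] linear_scale[OF L(1)]
         mink.add_left mink.scaleR_left)
  have expand: "v = (\<Sum>i\<in>UNIV. v $ i *\<^sub>R axis i 1)" for v :: "real ^ 3"
    by (simp add: vec_eq_iff axis_def if_distrib cong: if_cong)
  have lin_eq: "g v = h v" if "linear g" "linear h" "\<And>i. g (axis i 1) = h (axis i 1)"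
    for g h :: "real ^ 3 \<Rightarrow> real" and v
    by (subst (1 2) expand) (simp add: linear_sum[OF that(1)] linear_sum[OF that(2)]
         linear_scale[OF that(1)] linear_scale[OF that(2)] that(3))
  have lin_mink: "linear (\<lambda>v. mink x (L v))" for x
    by (rule linearI) (auto simp: linear_add[OF L(1)] linear_scale[OF L(1)]
         mink.add_right mink.scaleR_right)
  have "inj G"
  proof (subst linear_injective_0[OF \<open>linear G\<close>], intro allI impI)
    fix u assume "G u = 0"
    then have "mink (L u) (L (axis i 1)) = 0" for i
      by (simp add: G_def vec_eq_iff)
    then have "mink (L u) (L v) = 0" for v
      by (rule lin_eq[OF lin_mink linear_zero, simplified])
    then have "L u = 0"
      using nondeg by blast
    then show "u = 0"
      using L linear_injective_0 by blast
  qed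
  then have "surj G"
    using \<open>linear G\<close> linear_injective_imp_surjective by blast
  then obtain u where u: "G u = (\<chi> i. f (axis i 1))"
    by (metis surjD)
  have "mink (L u) (L v) = f v" for v
    by (rule lin_eq[OF lin_mink f]) (use u in \<open>simp add: G_def vec_eq_iff\<close>)
  then have ex: "L u \<in> range L \<and> (\<forall>v. mink (L u) (L v) = f v)"
    by blast
  show ?thesis
  proof (rule ex1I[where a = "L u"])
    show "L u \<in> range L \<and> (\<forall>v. mink (L u) (L v) = f v)"
      by (rule ex)
  next
    fix V assume V: "V \<in> range L \<and> (\<forall>v. mink V (L v) = f v)"
    have "V - L u \<in> range L"
      using V ex range_L by (auto simp: mink.diff_right)
    moreover have "mink (V - L u) (L v) = 0" for v
      using V ex by (simp add: mink.diff_left)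
    ultimately show "V = L u"
      using nondeg[of "V - L u"] by simp
  qed
qed

text \<open>Differentiability of \<open>f\<close> makes its derivative linear, so the definite
  description in \<open>surf_grad\<close> denotes an actual tangent vector.\<close>

lemma surf_grad_normal:
  assumes "X differentiable (at p)" "inj (frechet_derivative X (at p))"
    and "mink n n \<noteq> 0" "\<And>v. mink n (frechet_derivative X (at p) v) = 0"
    and "f differentiable (at p)"
  shows "mink n (surf_grad X f p) = 0"
proof -
  have "surf_grad X f p \<in> range (frechet_derivative X (at p))"
    unfolding surf_grad_def
    using theI'[OF mink_gradient_ex1[OF linear_frechet_derivative[OF assms(1)] assms(2-4)
        linear_frechet_derivative[OF assms(5)]]] by blast
  then show ?thesis
    using assms(4) by auto
qed

section \<open>Shape operators with a double eigenvalue and their curvature coefficients\<close>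

lemma charpoly_double_eigenvector:
  fixes A :: "real ^ 3 ^ 3"
  assumes "A *v axis 2 1 = c *\<^sub>R axis 2 1" "A *v axis 3 1 = c *\<^sub>R axis 3 1"
  shows "charpoly A = [:- (A $ 1 $ 1), 1:] * [:- c, 1:] * [:- c, 1:]"
proof -
  \<comment> \<open>The two eigenvectors fix the second and third columns, so \<open>A\<close> is
    lower triangular and its diagonal gives the polynomial; \<open>A\<close> need not be
    diagonalizable.\<close>
  have "(A *v axis l 1) $ i = A $ i $ l" for i l
    by (simp add: matrix_vector_mult_basis column_def)
  then have "A $ i $ 2 = (if i = 2 then c else 0)" "A $ i $ 3 = (if i = 3 then c else 0)" for i
    using arg_cong[OF assms(1), of "\<lambda>x. x $ i"] arg_cong[OF assms(2), of "\<lambda>x. x $ i"]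
    by (simp_all add: axis_def)
  then show ?thesis
    by (simp add: charpoly_def det_3)
qed

lemma curv_coeff_repeated:
  fixes a c :: real
  assumes "charpoly (shape_operator X N p) = [:- a, 1:] * [:- c, 1:] * [:- c, 1:]"
  shows "curv_coeff X N 1 p = - (a + 2 * c)"
    and "curv_coeff X N 2 p = c\<^sup>2 + 2 * a * c"
    and "curv_coeff X N 3 p = - (a * c\<^sup>2)"
proof -
  have "proots (charpoly (shape_operator X N p)) = {#a, c, c#}"
    unfolding assms by (subst proots_mult, simp, simp)+ simp
  \<comment> \<open>Sorting puts the simple root first or last; the symmetric sums below are the
    same in both cases.\<close>
  then have list: "principal_curvatures X N p = (if a \<le> c then [a, c, c] else [c, c, a])"
    by (simp add: principal_curvatures_def)
  have len: "length (principal_curvatures X N p) = 3"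
    by (simp add: list)
  have "{..<3} = {0, 1, 2::nat}"
    by auto
  moreover have "Pow {0, 1, 2::nat} = {{}, {0}, {1}, {2}, {0, 1}, {0, 2}, {1, 2}, {0, 1, 2}}"
    by (simp add: Pow_insert insert_commute)
  ultimately have sub: "{A. A \<subseteq> {..<3::nat} \<and> card A = m} =
      {A \<in> {{}, {0}, {1}, {2}, {0, 1}, {0, 2}, {1, 2}, {0, 1, 2}}. card A = m}" for m
    by (metis Pow_iff)
  have sub1: "{A. A \<subseteq> {..<3::nat} \<and> card A = 1} = {{0}, {1}, {2}}"
    and sub2: "{A. A \<subseteq> {..<3::nat} \<and> card A = 2} = {{0, 1}, {0, 2}, {1, 2}}"
    and sub3: "{A. A \<subseteq> {..<3::nat} \<and> card A = 3} = {{0, 1, 2}}"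
    unfolding sub by auto
  \<comment> \<open>The index pairs must be known to be distinct for the sum over them to split into
    three terms.\<close>
  have neq: "{0, 1} \<noteq> {0, 2::nat}" "{0, 1} \<noteq> {1, 2::nat}" "{0, 2} \<noteq> {1, 2::nat}"
    by (simp_all add: doubleton_eq_iff)
  show "curv_coeff X N 1 p = - (a + 2 * c)"
    unfolding curv_coeff_def Let_def len sub1 by (simp add: list)
  show "curv_coeff X N 2 p = c\<^sup>2 + 2 * a * c"
    unfolding curv_coeff_def Let_def len sub2 using neq
    by (simp add: list power2_eq_square)
  show "curv_coeff X N 3 p = - (a * c\<^sup>2)"
    unfolding curv_coeff_def Let_def len sub3
    by (simp add: list power2_eq_square)
qed

text \<open>Here \<open>T\<close> stands for \<open>F 1\<close>, \<open>D\<close> for the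
  differential of the direction field \<open>Y\<close>, and \<open>n\<close> for \<open>Y\<close> at
  the point. On \<open>v $ 1 = 0\<close> the two differentials are proportional, which gives the
  double eigenvalue; pairing with \<open>T\<close> isolates the remaining diagonal entry.\<close>

lemma shape_operator_tube:
  fixes X N :: "real ^ 3 \<Rightarrow> real ^ 4"
  assumes dX: "(X has_derivative (\<lambda>v. v $ 1 *\<^sub>R T + r *\<^sub>R D v)) (at p)"
    and dN: "(N has_derivative (\<lambda>v. - \<rho> *\<^sub>R D v)) (at p)"
    and inj: "inj (frechet_derivative X (at p))"
    and T: "mink T T = 1" "mink n T = 0" and n: "n \<noteq> 0" "\<And>v. mink n (D v) = 0"
    and g: "\<And>v. mink T (D v) = v $ 1 * g" and r: "r \<noteq> 0"
  shows "1 + r * g \<noteq> 0"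
    and "charpoly (shape_operator X N p) =
      [:- (\<rho> * g / (1 + r * g)), 1:] * [:- (\<rho> / r), 1:] * [:- (\<rho> / r), 1:]"
proof -
  let ?L = "\<lambda>v. v $ 1 *\<^sub>R T + r *\<^sub>R D v"
  have fX: "frechet_derivative X (at p) = ?L" and fN: "frechet_derivative N (at p) = (\<lambda>v. - \<rho> *\<^sub>R D v)"
    using frechet_derivative_at[OF dX] frechet_derivative_at[OF dN] by simp_all
  have L: "linear ?L" "inj ?L"
    using has_derivative_linear[OF dX] inj unfolding fX by auto
  have perp: "mink n (?L v) = 0" for v
    using T n by (simp add: mink.add_right mink.scaleR_right)
  have range_L: "range ?L = {x. mink n x = 0}"
    by (rule range_eq_mink_orthogonal[OF L n(1) perp])
  have T_L: "mink T (?L v) = v $ 1 * (1 + r * g)" for v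
    using T g by (simp add: mink.add_right mink.scaleR_right algebra_simps)
  \<comment> \<open>Being orthogonal to \<open>n\<close>, the vector \<open>T\<close> is tangent.
    Pairing \<open>T = ?L v\<close> with \<open>T\<close> gives
    \<open>1 = v $ 1 * (1 + r * g)\<close>.\<close>
  have "T \<in> range ?L"
    unfolding range_L using T(2) by simp
  then obtain v where "T = ?L v"
    by blast
  then show nz: "1 + r * g \<noteq> 0"
    using T_L[of v] T(1) by auto
  obtain M where M: "linear M" "M \<circ> ?L = id"
    using linear_injective_left_inverse[OF L] by blast
  \<comment> \<open>Each \<open>\<rho> *\<^sub>R D v\<close> is tangent, so the left inverse
    \<open>M\<close> of the differential of \<open>X\<close> pulls it back exactly.\<close>
  define S where "S = matrix (\<lambda>v. M (\<rho> *\<^sub>R D v))"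
  have "linear (\<lambda>v. - \<rho> *\<^sub>R D v)"
    using has_derivative_linear[OF dN] .
  then have "linear (\<lambda>v. - (- \<rho> *\<^sub>R D v))"
    by (rule linear_compose_neg)
  then have lin: "linear (\<lambda>v. M (\<rho> *\<^sub>R D v))"
    using linear_compose[OF _ M(1)] by (auto simp: o_def)
  have S: "?L (S *v v) = \<rho> *\<^sub>R D v" for v
  proof -
    have "\<rho> *\<^sub>R D v \<in> range ?L"
      unfolding range_L using n by (simp add: mink.scaleR_right)
    then obtain u where u: "\<rho> *\<^sub>R D v = ?L u"
      by blast
    have "S *v v = M (\<rho> *\<^sub>R D v)"
      unfolding S_def using matrix_works[OF lin[folded linear_matrix_vector_mul_eq]] by simp
    also have "\<dots> = u"
      unfolding u using fun_cong[OF M(2), of u] by simp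
    finally show ?thesis
      by (simp add: u)
  qed
  have sh: "shape_operator X N p = S"
    unfolding shape_operator_def fX fN
  proof (rule the_equality)
    show "\<forall>v. ?L (S *v v) = - (- \<rho> *\<^sub>R D v)"
      using S by simp
    fix S' assume "\<forall>v. ?L (S' *v v) = - (- \<rho> *\<^sub>R D v)"
    then have "?L (S' *v v) = ?L (S *v v)" for v
      using S by simp
    then have "S' *v v = S *v v" for v
      using injD[OF L(2)] by blast
    then show "S' = S"
      by (simp add: matrix_eq)
  qed
  have eig: "S *v v = (\<rho> / r) *\<^sub>R v" if "v $ 1 = 0" for v
  proof (rule injD[OF L(2)])
    have "?L ((\<rho> / r) *\<^sub>R v) = (\<rho> / r) *\<^sub>R ?L v"
      by (rule linear_scale[OF L(1)])
    then show "?L (S *v v) = ?L ((\<rho> / r) *\<^sub>R v)"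
      using S[of v] that r by simp
  qed
  \<comment> \<open>Both sides of \<open>?L (S e_1) = \<rho> *\<^sub>R D e_1\<close> are paired with
    \<open>T\<close>.\<close>
  have "(S *v axis 1 1) $ 1 * (1 + r * g) = \<rho> * g"
    using T_L[of "S *v axis 1 1"] S[of "axis 1 1"] g[of "axis 1 1"]
    by (simp add: mink.scaleR_right)
  then have S11: "S $ 1 $ 1 = \<rho> * g / (1 + r * g)"
    using nz by (simp add: matrix_vector_mult_basis column_def field_simps)
  show "charpoly (shape_operator X N p) =
      [:- (\<rho> * g / (1 + r * g)), 1:] * [:- (\<rho> / r), 1:] * [:- (\<rho> / r), 1:]"
    unfolding sh S11[symmetric]
    by (rule charpoly_double_eigenvector; rule eig) (simp_all add: axis_def)
qed

section \<open>The direction field \<open>Y\<close> of the tube and its coefficient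
  functions\<close>

definition offset :: "nat \<Rightarrow> int \<Rightarrow> (nat \<Rightarrow> real \<Rightarrow> real ^ 4) \<Rightarrow> real ^ 3 \<Rightarrow> real ^ 4"
  where "offset j lam F p = (\<Sum>i = 2..4. mu j lam i (p $ 2) (p $ 3) *\<^sub>R F i (p $ 1))"

lemma sum_2_4: "(\<Sum>i = 2..4. h i) = h 2 + h 3 + h (4::nat)" for h :: "nat \<Rightarrow> 'a::comm_monoid_add"
  by (simp add: eval_nat_numeral add.assoc)

lemma mu_differentiable:
  assumes "j \<in> {2, 3, 4}" "lam \<in> {1, -1}"
  shows "(\<lambda>p::real ^ 3. mu j lam i (p $ 2) (p $ 3)) differentiable (at p)"
proof -
  have proj: "((\<lambda>p::real ^ 3. p $ l) has_derivative (\<lambda>v. v $ l)) (at p)" for l p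
    by (rule bounded_linear.has_derivative[OF bounded_linear_vec_nth has_derivative_ident])
  have sc: "(\<lambda>p::real ^ 3. sinh (p $ l)) differentiable (at p)"
    "(\<lambda>p::real ^ 3. cosh (p $ l)) differentiable (at p)" for l
  proof -
    have "((\<lambda>x. sinh x) has_derivative (\<lambda>h. cosh (p $ l) * h)) (at (p $ l))"
      "((\<lambda>x. cosh x) has_derivative (\<lambda>h. sinh (p $ l) * h)) (at (p $ l))"
      by (auto intro!: derivative_eq_intros)
    from this[THEN has_derivative_compose[OF proj]]
    show "(\<lambda>p::real ^ 3. sinh (p $ l)) differentiable (at p)"
      "(\<lambda>p::real ^ 3. cosh (p $ l)) differentiable (at p)"
      unfolding differentiable_def by blast+
  qed
  \<comment> \<open>The exponents are 0 or 1, so each power is a plain factor or 1, and zeros of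
    \<open>sinh\<close> cause no trouble.\<close>
  have fin: "sinh x powi ((1 + lam) div 2) = (if lam = 1 then sinh x else 1)"
    "cosh x powi ((1 + lam) div 2) = (if lam = 1 then cosh x else 1)"
    "sinh x powi ((1 - lam) div 2) = (if lam = 1 then 1 else sinh x)"
    "cosh x powi ((1 - lam) div 2) = (if lam = 1 then 1 else cosh x)" for x :: real
    using assms(2) by auto
  show ?thesis
    unfolding mu_def fin
    by (cases "lam = 1"; cases "i = j"; cases "i = cyc (j + 1)"; cases "i = cyc (j + 2)")
      (auto intro!: differentiable_mult sc)
qed

text \<open>The sum is the Lorentzian square of \<open>Y\<close>. The terms with
  \<open>cosh t\<close> and \<open>sinh t\<close> share a factor and merge by
  \<open>cosh^2 - sinh^2 = 1\<close>; the same identity in \<open>w\<close> then leaves the sign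
  \<open>lam\<close>.\<close>

lemma mu_hyperbolic:
  assumes "j \<in> {2, 3, 4}" "lam \<in> {1, -1}"
  shows "(\<Sum>i = 2..4. (if i = j then -1 else 1) * (mu j lam i t w)\<^sup>2) = of_int lam"
  unfolding sum_2_4 using assms
  by (elim insertE emptyE; simp add: mu_def cyc_def power_mult_distrib cosh_square_eq ring_distribs)

lemma smooth_curve_on_differentiable:
  assumes "smooth_curve_on I f" "open I" "s \<in> I"
  obtains D where "(f has_vector_derivative D) (at s)"
proof -
  obtain D where D: "\<And>s. s \<in> I \<Longrightarrow> D 0 s = f s"
    "\<And>s. s \<in> I \<Longrightarrow> (D 0 has_vector_derivative D (Suc 0) s) (at s)"
    using assms(1) unfolding smooth_curve_on_def by blast
  \<comment> \<open>\<open>D 0\<close> is known to agree with \<open>f\<close> only on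
    \<open>I\<close>; openness of \<open>I\<close> carries the derivative over.\<close>
  have "(f has_vector_derivative D (Suc 0) s) (at s)"
    by (rule has_vector_derivative_transform_within_open[OF D(2)[OF assms(3)] assms(2,3)])
      (use D(1) in auto)
  then show ?thesis
    by (rule that)
qed

section \<open>Geometry of the tube over its parameter domain\<close>

locale tube_patch =
  fixes j :: nat and lam :: int and r :: real and I :: "real set"
    and \<beta> :: "real \<Rightarrow> real ^ 4" and F :: "nat \<Rightarrow> real \<Rightarrow> real ^ 4"
    and k :: "nat \<Rightarrow> real \<Rightarrow> real" and U :: "(real ^ 3) set"
  assumes j: "j \<in> {2, 3, 4}" and lam: "lam \<in> {1, -1}" and r: "r > 0" and I: "open I"
    and frenet: "frenet_curve j I \<beta> F k"
    and U: "open U" "\<And>p. p \<in> U \<Longrightarrow> p $ 1 \<in> I"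
    and immersion: "immersion_on (tube j lam r \<beta> F) U"
begin

abbreviation "X \<equiv> tube j lam r \<beta> F"
abbreviation "N \<equiv> tube_normal j lam F"
abbreviation "Y \<equiv> offset j lam F"

definition \<rho> :: real where "\<rho> = (-1) ^ fact (4 - j) * of_int lam ^ j"

text \<open>The \<open>F 1\<close> component of the \<open>s\<close>-derivative of \<open>Y\<close>,
  in a form uniform in \<open>j\<close>: since \<open>mink (F 2) (F 2)\<close> is -1 for
  \<open>j = 2\<close> and 1 otherwise, on the tube \<open>g\<close> is
  \<open>(-1)^((4-j)!) k_1 mu_2\<close>.\<close>

definition g :: "real ^ 3 \<Rightarrow> real" where
  "g p = - (k 1 (p $ 1) * mink (F 2 (p $ 1)) (Y p))"

lemma rho_sq: "\<rho>\<^sup>2 = 1"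
  using lam by (auto simp: \<rho>_def power_mult_distrib simp flip: power_mult)

lemma lam_sq: "(of_int lam :: real)\<^sup>2 = 1"
  using lam by auto

lemma X_eq: "X p = \<beta> (p $ 1) + r *\<^sub>R Y p"
  by (simp add: tube_def offset_def)

lemma N_eq: "N p = - \<rho> *\<^sub>R Y p"
  by (simp add: tube_normal_def offset_def \<rho>_def)

lemma orthonormal:
  assumes "s \<in> I" "i \<in> {1..4}" "l \<in> {1..4}"
  shows "mink (F i s) (F l s) = (if i \<noteq> l then 0 else if i = j then -1 else 1)"
  using frenet assms unfolding frenet_curve_def by blast

lemma compose_fst:
  assumes "(f has_vector_derivative d) (at (p $ 1))"
  shows "((\<lambda>p::real ^ 3. f (p $ 1)) has_derivative (\<lambda>v. v $ 1 *\<^sub>R d)) (at p)"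
  using has_derivative_compose[OF
      bounded_linear.has_derivative[OF bounded_linear_vec_nth has_derivative_ident]
      assms[unfolded has_vector_derivative_def]] .

lemma frame_differentiable:
  assumes "p $ 1 \<in> I" "i \<in> {1..4}"
  shows "(\<lambda>p::real ^ 3. F i (p $ 1)) differentiable (at p)"
proof -
  have "smooth_curve_on I (F i)"
    using frenet assms(2) unfolding frenet_curve_def by blast
  then obtain D where "(F i has_vector_derivative D) (at (p $ 1))"
    using smooth_curve_on_differentiable I assms(1) by metis
  from compose_fst[OF this] show ?thesis
    unfolding differentiable_def by blast
qed

lemma F1_deriv:
  assumes "p $ 1 \<in> I"
  shows "((\<lambda>p::real ^ 3. F 1 (p $ 1)) has_derivative
           (\<lambda>v. v $ 1 *\<^sub>R k 1 (p $ 1) *\<^sub>R F 2 (p $ 1))) (at p)"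
proof (rule compose_fst)
  show "(F 1 has_vector_derivative k 1 (p $ 1) *\<^sub>R F 2 (p $ 1)) (at (p $ 1))"
    using frenet j assms unfolding frenet_curve_def by blast
qed

lemma Y_differentiable:
  assumes "p $ 1 \<in> I"
  shows "Y differentiable (at p)"
  unfolding offset_def
  by (intro differentiable_sum differentiable_scaleR ballI)
    (use j lam assms in \<open>auto intro!: mu_differentiable frame_differentiable\<close>)

lemma mink_Y_Y: "p $ 1 \<in> I \<Longrightarrow> mink (Y p) (Y p) = of_int lam"
  unfolding mu_hyperbolic[OF j lam, of "p $ 2" "p $ 3", symmetric]
  by (simp add: offset_def sum_2_4 mink.add_left mink.add_right mink.scaleR_left
      mink.scaleR_right orthonormal power2_eq_square)

lemma mink_F1_Y: "p $ 1 \<in> I \<Longrightarrow> mink (F 1 (p $ 1)) (Y p) = 0"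
  by (simp add: offset_def sum_2_4 mink.add_right mink.scaleR_right orthonormal)

lemma g_differentiable:
  assumes "p $ 1 \<in> I"
  shows "g differentiable (at p)"
proof -
  have "smooth_curve_on I (k 1)"
    using frenet unfolding frenet_curve_def by auto
  then obtain D where "(k 1 has_vector_derivative D) (at (p $ 1))"
    using smooth_curve_on_differentiable I assms by metis
  from compose_fst[OF this]
  have "(\<lambda>p::real ^ 3. k 1 (p $ 1)) differentiable (at p)"
    unfolding differentiable_def by blast
  moreover have "(\<lambda>p. mink (F 2 (p $ 1)) (Y p)) differentiable (at p)"
    using frame_differentiable[OF assms, of 2] Y_differentiable[OF assms]
    unfolding differentiable_def by (auto dest: mink.FDERIV)
  ultimately show ?thesis
    unfolding g_def by (intro differentiable_minus differentiable_mult)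
qed

text \<open>Serves to differentiate the identities \<open>mink (Y q) (Y q) = lam\<close> and
  \<open>mink (F 1) (Y q) = 0\<close>, which hold throughout the open set \<open>U\<close>.\<close>

lemma locally_constant_derivative:
  fixes h :: "real ^ 3 \<Rightarrow> real"
  assumes "(h has_derivative d) (at p)" "p \<in> U" "\<And>q. q \<in> U \<Longrightarrow> h q = c"
  shows "d v = 0"
proof -
  have "((\<lambda>_. c) has_derivative d) (at p)"
    by (rule has_derivative_transform_within_open[OF assms(1) U(1) assms(2)]) (use assms in auto)
  then show ?thesis
    using has_derivative_unique[OF _ has_derivative_const] by fastforce
qed

lemma
  assumes p: "p \<in> U"
  shows one_plus_r_g_nonzero: "1 + r * g p \<noteq> 0"
    and charpoly_tube: "charpoly (shape_operator X N p) =
      [:- (\<rho> * g p / (1 + r * g p)), 1:] * [:- (\<rho> / r), 1:] * [:- (\<rho> / r), 1:]"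
    and normal: "\<And>v. mink (Y p) (frechet_derivative X (at p) v) = 0"
proof -
  have s: "p $ 1 \<in> I"
    using U p by blast
  obtain D where D: "(Y has_derivative D) (at p)"
    using Y_differentiable[OF s] unfolding differentiable_def by blast
  have "(\<beta> has_vector_derivative F 1 (p $ 1)) (at (p $ 1))"
    using frenet s unfolding frenet_curve_def by blast
  from has_derivative_add[OF compose_fst[OF this] has_derivative_scaleR_right[OF D, of r]]
  have dX: "(X has_derivative (\<lambda>v. v $ 1 *\<^sub>R F 1 (p $ 1) + r *\<^sub>R D v)) (at p)"
    unfolding X_eq[abs_def] .
  have dN: "(N has_derivative (\<lambda>v. - \<rho> *\<^sub>R D v)) (at p)"
    unfolding N_eq[abs_def] by (rule has_derivative_scaleR_right[OF D])
  have inj: "inj (frechet_derivative X (at p))"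
    using immersion p unfolding immersion_on_def by blast
  have T: "mink (F 1 (p $ 1)) (F 1 (p $ 1)) = 1"
    using orthonormal[OF s, of 1 1] j by auto
  have YT: "mink (Y p) (F 1 (p $ 1)) = 0"
    using mink_F1_Y[OF s] by (simp add: mink_commute)
  have Y0: "Y p \<noteq> 0"
    using mink_Y_Y[OF s] lam by (auto simp: mink.zero_left)
  \<comment> \<open>\<open>Y\<close> has constant Lorentzian square, so its differential is
    orthogonal to it.\<close>
  have "mink (Y p) (D v) + mink (D v) (Y p) = 0" for v
    by (rule locally_constant_derivative[OF mink.FDERIV[OF D D] p]) (use mink_Y_Y U in blast)
  from this[unfolded mink_commute[of "D _"]] have YD: "mink (Y p) (D v) = 0" for v
    by simp
  \<comment> \<open>Differentiating the orthogonality of \<open>F 1\<close> and \<open>Y\<close>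
    brings in \<open>F_1' = k_1 F_2\<close>, which has the same form for all three \<open>j\<close>;
    this avoids expanding the derivative of \<open>Y\<close>.\<close>
  have "mink (F 1 (p $ 1)) (D v) + mink (v $ 1 *\<^sub>R k 1 (p $ 1) *\<^sub>R F 2 (p $ 1)) (Y p) = 0" for v
    by (rule locally_constant_derivative[OF mink.FDERIV[OF F1_deriv[OF s] D] p])
      (use mink_F1_Y U in blast)
  then have gD: "mink (F 1 (p $ 1)) (D v) = v $ 1 * g p" for v
    unfolding g_def by (simp add: mink.scaleR_left eq_neg_iff_add_eq_0 mult.assoc)
  have "r \<noteq> 0"
    using r by simp
  from shape_operator_tube[OF dX dN inj T YT Y0 YD gD this]
  show "1 + r * g p \<noteq> 0" "charpoly (shape_operator X N p) =
      [:- (\<rho> * g p / (1 + r * g p)), 1:] * [:- (\<rho> / r), 1:] * [:- (\<rho> / r), 1:]"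
    by auto
  show "mink (Y p) (frechet_derivative X (at p) v) = 0" for v
    using YT YD by (simp flip: frechet_derivative_at[OF dX] add: mink.add_right mink.scaleR_right)
qed

lemma mink_N_N: "p \<in> U \<Longrightarrow> mink (N p) (N p) = of_int lam"
  using mink_Y_Y[of p] U(2) rho_sq
  by (simp add: N_eq mink.scaleR_left mink.scaleR_right power2_eq_square
      mink.minus_left mink.minus_right flip: mult.assoc)

section \<open>Mean curvatures and the normal component of \<open>L1_gauss\<close>\<close>

lemma mean_curv_tube:
  assumes "p \<in> U"
  defines "a \<equiv> \<rho> * g p / (1 + r * g p)" and "c \<equiv> \<rho> / r"
  shows "mean_curv X N 1 p = of_int lam * (a + 2 * c) / 3"
    and "mean_curv X N 2 p = (c\<^sup>2 + 2 * a * c) / 3"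
    and "mean_curv X N 3 p = of_int lam * (a * c\<^sup>2)"
proof -
  have choose: "(3 choose 2) = (3::nat)"
    by (simp add: eval_nat_numeral)
  \<comment> \<open>Since \<open>\<epsilon> = lam\<close> squares to 1, only the odd-order mean
    curvatures keep a factor \<open>lam\<close>.\<close>
  have "(- real_of_int lam) ^ 3 = - of_int lam"
    using lam by auto
  then show "mean_curv X N 1 p = of_int lam * (a + 2 * c) / 3"
    "mean_curv X N 2 p = (c\<^sup>2 + 2 * a * c) / 3"
    "mean_curv X N 3 p = of_int lam * (a * c\<^sup>2)"
    unfolding mean_curv_def mink_N_N[OF assms(1)]
      curv_coeff_repeated[OF charpoly_tube[OF assms(1), folded a_def c_def]]
    by (simp_all add: choose lam_sq algebra_simps)
qed

text \<open>Without differentiability of \<open>H\<^sub>2\<close>, both \<open>frechet_derivative\<close> and the definite description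
  in \<open>surf_grad\<close> would be junk.\<close>

lemma mean_curv_2_differentiable:
  assumes "p \<in> U"
  shows "mean_curv X N 2 differentiable (at p)"
proof -
  let ?c = "\<rho> / r"
  have "(\<lambda>q. (?c\<^sup>2 + 2 * (\<rho> * g q / (1 + r * g q)) * ?c) / 3) differentiable (at p)"
    using g_differentiable[OF U(2)[OF assms]] one_plus_r_g_nonzero[OF assms]
    by (intro differentiable_divide differentiable_add differentiable_mult differentiable_const)
      auto
  then obtain d where "((\<lambda>q. (?c\<^sup>2 + 2 * (\<rho> * g q / (1 + r * g q)) * ?c) / 3) has_derivative d) (at p)"
    unfolding differentiable_def by blast
  then have "(mean_curv X N 2 has_derivative d) (at p)"
    by (rule has_derivative_transform_within_open[OF _ U(1) assms])
      (simp add: mean_curv_tube)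
  then show ?thesis
    unfolding differentiable_def by blast
qed

lemma L1_gauss_nonzero:
  assumes p: "p \<in> U"
  shows "L1_gauss X N p \<noteq> 0"
proof
  define a c where "a = \<rho> * g p / (1 + r * g p)" and "c = \<rho> / r"
  define h where
    "h = 3 * mean_curv X N 1 p * mean_curv X N 2 p - mean_curv X N 3 p"
  assume "L1_gauss X N p = 0"
  moreover have "(3 choose 2) = (3::nat)"
    by (simp add: eval_nat_numeral)
  \<comment> \<open>The prefactor \<open>- \<epsilon> * C1\<close> equals
    \<open>3 * \<epsilon>^2 = 3\<close> and can be cancelled.\<close>
  ultimately have "surf_grad X (mean_curv X N 2) p + h *\<^sub>R N p = 0"
    using lam by (auto simp: L1_gauss_def Let_def h_def mink_N_N[OF p])
  then have "mink (N p) (surf_grad X (mean_curv X N 2) p) + h * mink (N p) (N p) = 0"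
    by (metis mink.add_right mink.scaleR_right mink.zero_right real_scaleR_def)
  moreover have "mink (N p) (surf_grad X (mean_curv X N 2) p) = 0"
  proof (rule surf_grad_normal)
    show "X differentiable (at p)" "inj (frechet_derivative X (at p))"
      using immersion p unfolding immersion_on_def by blast+
    show "mink (N p) (N p) \<noteq> 0"
      using mink_N_N[OF p] lam by auto
    show "mink (N p) (frechet_derivative X (at p) v) = 0" for v
      using normal[OF p] by (simp add: N_eq mink.minus_left mink.scaleR_left)
  qed (rule mean_curv_2_differentiable[OF p])
  ultimately have "h = 0"
    using mink_N_N[OF p] lam by auto
  moreover have "h = of_int lam * (2 / 3 * c * (c\<^sup>2 + a * c + a\<^sup>2))"
    unfolding h_def mean_curv_tube[OF p] a_def[symmetric] c_def[symmetric]
    by (simp add: field_simps power2_eq_square)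
  moreover have "c \<noteq> 0"
    using rho_sq r by (auto simp: c_def)
  moreover have "c\<^sup>2 + a * c + a\<^sup>2 > 0"
  proof -
    \<comment> \<open>Completing the square shows that \<open>c \<noteq> 0\<close> suffices for
      positivity, whatever the third curvature \<open>a\<close> is.\<close>
    have "c\<^sup>2 + a * c + a\<^sup>2 = (a + c / 2)\<^sup>2 + 3 / 4 * c\<^sup>2"
      by (simp add: power2_eq_square field_simps)
    then show ?thesis
      using \<open>c \<noteq> 0\<close> by (simp add: add_nonneg_pos)
  qed
  ultimately show False
    using lam by auto
qed

end

theorem theorem12:
  fixes j :: nat and lam :: int and r :: real
    and I :: "real set" and \<beta> :: "real \<Rightarrow> real ^ 4"
    and F :: "nat \<Rightarrow> real \<Rightarrow> real ^ 4" and k :: "nat \<Rightarrow> real \<Rightarrow> real"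
    and U :: "(real ^ 3) set"
  assumes "j \<in> {2, 3, 4}" and "lam \<in> {1, -1}" and "r > 0"
    and "open I" and "is_interval I"
    and "frenet_curve j I \<beta> F k"
    and "open U" and "connected U" and "U \<noteq> {}" and "(\<lambda>p. p $ 1) ` U = I"
    and "immersion_on (tube j lam r \<beta> F) U"
  shows "\<not> L1_harmonic_gauss_on (tube j lam r \<beta> F) (tube_normal j lam F) U"
proof -
  interpret tube_patch j lam r I \<beta> F k U
    using assms by unfold_locales auto
  \<comment> \<open>Harmonicity fails at every point, and \<open>U\<close> being nonempty supplies
    one.\<close>
  show ?thesis
    using L1_gauss_nonzero assms(9) unfolding L1_harmonic_gauss_on_def by blast
qed

end
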